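(* Let $A$ be a dendriform algebra, $n\ge 1$, and $a_1,\ldots,a_n\in A$. Then $$\sum_{\sigma\in S_n}\big(\cdots(a_{\sigma_1}\succ a_{\sigma_2})\succ\cdots\big)\succ a_{\sigma_n}=\sum_{\sigma\in S_n}T_\sigma(a_1,\ldots,a_n),$$ $$\sum_{\sigma\in S_n}a_{\sigma_1}\prec\big(\cdots(a_{\sigma_{n-1}}\prec a_{\sigma_n})\cdots\big)=\sum_{\sigma\in S_n}U_\sigma(a_1,\ldots,a_n).$$
   Context: A dendriform algebra is a vector space $A$ with bilinear operations $\prec,\succ$ satisfying $(a\prec b)\prec c=a\prec(b*c)$, $(a\succ b)\prec c=a\succ(b\prec c)$, $a\succ(b\succ c)=(a*b)\succ c$, where $a*b:=a\prec b+a\succ b$ (associative). Put $a\rhd b:=a\succ b-b\prec a$, $a\lhd b:=a\prec b-b\succ a$, $\ell^{(m)}(b_1,\ldots,b_m):=(\cdots((b_1\rhd b_2)\rhd b_3)\cdots)\rhd b_m$ and $r^{(m)}(b_1,\ldots,b_m):=b_1\lhd(b_2\lhd(\cdots(b_{m-1}\lhd b_m)\cdots))$, with $\ell^{(1)}(b)=r^{(1)}(b)=b$. Write $\sigma_i=\sigma(i)$. For $\sigma\in S_n$, let $E_\sigma$ be the set of $k\in\{1,\ldots,n-1\}$ such that $\sigma_{k+1}>\sigma_j$ for all $j\le k$; write $E_\sigma=\{k_1<\cdots<k_p\}$, $k_0:=0$, $k_{p+1}:=n$, and set $T_\sigma(a_1,\ldots,a_n):=\ell^{(k_1-k_0)}(a_{\sigma_{k_0+1}},\ldots,a_{\sigma_{k_1}})*\cdots*\ell^{(k_{p+1}-k_p)}(a_{\sigma_{k_p+1}},\ldots,a_{\sigma_n})$.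 Similarly let $F_\sigma$ be the set of $l\in\{1,\ldots,n-1\}$ such that $\sigma_l<\sigma_j$ for all $j\ge l+1$; write $F_\sigma=\{l_1<\cdots<l_q\}$, $l_0:=0$, $l_{q+1}:=n$, and set $U_\sigma(a_1,\ldots,a_n):=r^{(l_1-l_0)}(a_{\sigma_{l_0+1}},\ldots,a_{\sigma_{l_1}})*\cdots*r^{(l_{q+1}-l_q)}(a_{\sigma_{l_q+1}},\ldots,a_{\sigma_n})$. *)

theory Defs
  imports Complex_Main "HOL-Combinatorics.Permutations"
begin

locale dendriform_algebra = vector_space scale
  for scale :: "'k::field \<Rightarrow> 'a::ab_group_add \<Rightarrow> 'a" +
  fixes prec :: "'a \<Rightarrow> 'a \<Rightarrow> 'a" (infixl "\<prec>" 70)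
    and succ :: "'a \<Rightarrow> 'a \<Rightarrow> 'a" (infixl "\<succ>" 70)
  assumes linear_prec_left: "Vector_Spaces.linear scale scale (\<lambda>a. a \<prec> b)"
    and linear_prec_right: "Vector_Spaces.linear scale scale (\<lambda>b. a \<prec> b)"
    and linear_succ_left: "Vector_Spaces.linear scale scale (\<lambda>a. a \<succ> b)"
    and linear_succ_right: "Vector_Spaces.linear scale scale (\<lambda>b. a \<succ> b)"
    and prec_prec: "(a \<prec> b) \<prec> c = a \<prec> (b \<prec> c + b \<succ> c)"
    and succ_prec: "(a \<succ> b) \<prec> c = a \<succ> (b \<prec> c)"
    and succ_succ: "a \<succ> (b \<succ> c) = (a \<prec> b + a \<succ> b) \<succ> c"

type_synonym 'a binop = "'a \<Rightarrow> 'a \<Rightarrow> 'a"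

definition dend_mult :: "'a::ab_group_add binop \<Rightarrow> 'a binop \<Rightarrow> 'a binop" where
  "dend_mult prec succ a b = prec a b + succ a b"

definition dend_rhd :: "'a::ab_group_add binop \<Rightarrow> 'a binop \<Rightarrow> 'a binop" where
  "dend_rhd prec succ a b = succ a b - prec b a"

definition dend_lhd :: "'a::ab_group_add binop \<Rightarrow> 'a binop \<Rightarrow> 'a binop" where
  "dend_lhd prec succ a b = prec a b - succ b a"

lemma (in dendriform_algebra) dend_mult_assoc:
  "dend_mult prec succ (dend_mult prec succ a b) c = dend_mult prec succ a (dend_mult prec succ b c)"
proof -
  have "(x + y) \<prec> z = x \<prec> z + y \<prec> z" for x y z
    by (rule module_hom.add [OF Vector_Spaces.linear.axioms(3) [OF linear_prec_left]])
  moreover have "x \<succ> (y + z) = x \<succ> y + x \<succ> z" for x y z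
    by (rule module_hom.add [OF Vector_Spaces.linear.axioms(3) [OF linear_succ_right]])
  ultimately show ?thesis
    by (simp add: dend_mult_def prec_prec succ_prec succ_succ add.assoc)
qed

text \<open>
  Bracketed products of a nonempty list: \<open>left_product f [b1, ..., bm]\<close> is
  \<open>f (... (f (f b1 b2) b3) ...) bm\<close> and \<open>right_product f [b1, ..., bm]\<close> is
  \<open>f b1 (f b2 (... (f b(m-1) bm) ...))\<close>; both are \<open>b1\<close> on \<open>[b1]\<close>. On the empty list they
  are unspecified.
\<close>

definition left_product :: "'a binop \<Rightarrow> 'a list \<Rightarrow> 'a" where
  "left_product f bs = foldl f (hd bs) (tl bs)"

definition right_product :: "'a binop \<Rightarrow> 'a list \<Rightarrow> 'a" where
  "right_product f bs = foldr f (butlast bs) (last bs)"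

definition E_set :: "nat \<Rightarrow> (nat \<Rightarrow> nat) \<Rightarrow> nat set" where
  "E_set n \<sigma> = {k \<in> {1..n - 1}. \<forall>j\<in>{1..k}. \<sigma> (k + 1) > \<sigma> j}"

definition F_set :: "nat \<Rightarrow> (nat \<Rightarrow> nat) \<Rightarrow> nat set" where
  "F_set n \<sigma> = {l \<in> {1..n - 1}. \<forall>j\<in>{l + 1..n}. \<sigma> l < \<sigma> j}"

text \<open>
  For \<open>K = {k1 < ... < kp}\<close>, \<open>cuts n K\<close> is \<open>[k0, k1, ..., kp, k(p+1)]\<close> with \<open>k0 = 0\<close> and
  \<open>k(p+1) = n\<close>, and \<open>blocks n K b\<close> is the list of the \<open>p + 1\<close> words
  \<open>[b (ki + 1), ..., b (k(i+1))]\<close>, \<open>i = 0, ..., p\<close>.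
\<close>

definition cuts :: "nat \<Rightarrow> nat set \<Rightarrow> nat list" where
  "cuts n K = 0 # sorted_list_of_set K @ [n]"

definition blocks :: "nat \<Rightarrow> nat set \<Rightarrow> (nat \<Rightarrow> 'a) \<Rightarrow> 'a list list" where
  "blocks n K b =
     map (\<lambda>i. map b [cuts n K ! i + 1 ..< cuts n K ! (i + 1) + 1]) [0 ..< card K + 1]"

text \<open>
  The outer product is taken with left bracketing, which is immaterial by
  \<open>dend_mult_assoc\<close>.
\<close>

definition T_term ::
  "'a::ab_group_add binop \<Rightarrow> 'a binop \<Rightarrow> nat \<Rightarrow> (nat \<Rightarrow> nat) \<Rightarrow> (nat \<Rightarrow> 'a) \<Rightarrow> 'a" where
  "T_term prec succ n \<sigma> a =
     left_product (dend_mult prec succ)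
       (map (left_product (dend_rhd prec succ)) (blocks n (E_set n \<sigma>) (\<lambda>i. a (\<sigma> i))))"

definition U_term ::
  "'a::ab_group_add binop \<Rightarrow> 'a binop \<Rightarrow> nat \<Rightarrow> (nat \<Rightarrow> nat) \<Rightarrow> (nat \<Rightarrow> 'a) \<Rightarrow> 'a" where
  "U_term prec succ n \<sigma> a =
     left_product (dend_mult prec succ)
       (map (right_product (dend_lhd prec succ)) (blocks n (F_set n \<sigma>) (\<lambda>i. a (\<sigma> i))))"

end

theory Submission
  imports Defs "HOL-Combinatorics.Multiset_Permutations"
begin

text \<open>
  For an index set \<open>S\<close> let \<open>L(S)\<close> be the sum of the left-bracketed \<open>\<succ>\<close>-products over all
  arrangements of \<open>S\<close>, and for \<open>x \<notin> V\<close> let \<open>M(x, V)\<close> be the sum of the left-bracketed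
  \<open>\<rhd>\<close>-products over all words that start with \<open>x\<close> and continue with an arrangement of \<open>V\<close>.
  Splitting off the last letter and using the dendriform axioms gives, by induction on \<open>S\<close>,
  \<open>L(S \<union> {x}) = \<Sum>U\<subseteq>S. L(U) * M(x, S - U)\<close> for every \<open>x \<notin> S\<close>. For \<open>x\<close> maximal the
  right-hand side satisfies the same recursion, since the last block of \<open>T_term\<close> starts at the
  maximal letter. The second identity is the first one in the opposite dendriform algebra,
  \<open>a \<prec>' b = b \<succ> a\<close> and \<open>a \<succ>' b = b \<prec> a\<close>, with words reversed and minimal letters in
  place of maximal ones.
\<close>

section \<open>Sums over the arrangements of a finite set\<close>

definition perm_sum :: "('i list \<Rightarrow> 'a::ab_group_add) \<Rightarrow> 'i set \<Rightarrow> 'a" where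
  "perm_sum f S = (\<Sum>w\<in>permutations_of_set S. f w)"

lemma perm_sum_empty [simp]: "perm_sum f {} = f []"
  by (simp add: perm_sum_def)

lemma perm_sum_cong:
  assumes "\<And>w. distinct w \<Longrightarrow> set w = S \<Longrightarrow> f w = g w"
  shows "perm_sum f S = perm_sum g S"
  unfolding perm_sum_def
  by (intro sum.cong) (auto simp: assms permutations_of_set_def)

lemma perm_sum_rev: "perm_sum (\<lambda>w. f (rev w)) S = perm_sum f S"
  unfolding perm_sum_def
  by (rule sum.reindex_bij_witness [of _ rev rev]) (auto simp: permutations_of_set_def)

text \<open>A nonempty arrangement amounts to its last letter together with an arrangement of the
  other letters. Left-bracketed products unfold at the last letter, so every recursion below starts
  here.\<close>

lemma perm_sum_snoc:
  assumes "finite S" "S \<noteq> {}"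
  shows "perm_sum f S = (\<Sum>s\<in>S. perm_sum (\<lambda>w. f (w @ [s])) (S - {s}))"
proof -
  have "(\<Sum>s\<in>S. perm_sum (\<lambda>w. f (w @ [s])) (S - {s})) =
        (\<Sum>(s, w)\<in>Sigma S (\<lambda>s. permutations_of_set (S - {s})). f (w @ [s]))"
    unfolding perm_sum_def using assms by (subst sum.Sigma) auto
  also have "\<dots> = perm_sum f S"
    unfolding perm_sum_def
  proof (rule sum.reindex_bij_witness
      [of _ "\<lambda>w. (last w, butlast w)" "\<lambda>(s, w). w @ [s]"], goal_cases)
    case (2 p)
    then obtain s w where "p = (s, w)" "s \<in> S" "set w = S - {s}" "distinct w"
      by (auto simp: permutations_of_set_def)
    then show ?case by (simp add: permutations_of_set_def insert_absorb)
  next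
    case (3 w)
    then have "w \<noteq> []" using assms(2) by (auto simp: permutations_of_set_def)
    then show ?case by simp
  next
    case (4 w)
    then have "distinct w" "set w = S" "w \<noteq> []"
      using assms(2) by (auto simp: permutations_of_set_def)
    then show ?case
      by (cases w rule: rev_cases) (auto simp: permutations_of_set_def)
  qed (simp_all add: split_beta)
  finally show ?thesis ..
qed

text \<open>Cut each arrangement at its only occurrence of \<open>x\<close>; \<open>U\<close>
  collects the letters in front of the cut.\<close>

lemma perm_sum_insert:
  assumes "finite S" "x \<notin> S"
  shows "perm_sum f (insert x S) =
    (\<Sum>U\<in>Pow S. perm_sum (\<lambda>u. perm_sum (\<lambda>v. f (u @ x # v)) (S - U)) U)"
proof -
  let ?A = "Sigma (Pow S) (\<lambda>U. permutations_of_set U \<times> permutations_of_set (S - U))"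
  \<comment> \<open>These recover \<open>u\<close> and \<open>v\<close> from
    \<open>u @ x # v\<close>; \<open>tl\<close> discards \<open>x\<close> itself.\<close>
  let ?before = "takeWhile (\<lambda>y. y \<noteq> x)" and ?after = "\<lambda>w. tl (dropWhile (\<lambda>y. y \<noteq> x) w)"
  have split: "?before (u @ x # v) = u" "?after (u @ x # v) = v" if "x \<notin> set u" for u v
  proof -
    have "y \<noteq> x" if "y \<in> set u" for y using that \<open>x \<notin> set u\<close> by blast
    then show "?before (u @ x # v) = u" "?after (u @ x # v) = v"
      by (simp_all add: takeWhile_append2 dropWhile_append2)
  qed
  have fin: "finite U" if "U \<in> Pow S" for U
    using that assms(1) by (auto intro: finite_subset)
  have "(\<Sum>U\<in>Pow S. perm_sum (\<lambda>u. perm_sum (\<lambda>v. f (u @ x # v)) (S - U)) U) =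
        (\<Sum>U\<in>Pow S. \<Sum>(u, v)\<in>permutations_of_set U \<times> permutations_of_set (S - U). f (u @ x # v))"
    unfolding perm_sum_def by (simp only: sum.cartesian_product)
  also have "\<dots> = (\<Sum>(U, u, v)\<in>?A. f (u @ x # v))"
    using assms(1) by (intro sum.Sigma) (simp_all add: fin)
  also have "\<dots> = perm_sum f (insert x S)"
    unfolding perm_sum_def
  proof (rule sum.reindex_bij_witness
      [of _ "\<lambda>w. (set (?before w), ?before w, ?after w)" "\<lambda>(U, u, v). u @ x # v"], goal_cases)
    case (1 p)
    then obtain u v where "p = (set u, u, v)" "x \<notin> set u"
      using assms(2) by (auto simp: permutations_of_set_def)
    then show ?case by (simp add: split)
  next
    case (2 p)
    then obtain u v where "p = (set u, u, v)" "distinct u" "distinct v" "set u \<subseteq> S" "set v = S - set u"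
      by (auto simp: permutations_of_set_def)
    moreover have "x \<notin> set u" "x \<notin> set v" "set u \<inter> set v = {}" "set u \<union> set v = S"
      using calculation assms(2) by blast+
    ultimately show ?case by (simp add: permutations_of_set_def)
  next
    case (3 w)
    then have "x \<in> set w" by (simp add: permutations_of_set_def)
    then obtain u v where "w = u @ x # v" "x \<notin> set u" by (metis split_list_first)
    then show ?case by (simp add: split)
  next
    case (4 w)
    then have w: "x \<in> set w" "set w = insert x S" "distinct w"
      by (simp_all add: permutations_of_set_def)
    then obtain u v where uv: "w = u @ x # v" "x \<notin> set u" by (metis split_list_first)
    have disj: "x \<notin> set v" "set u \<inter> set v = {}"
      using w(3) unfolding uv(1) by auto
    have "insert x (set u \<union> set v) = insert x S"
      using w(2) unfolding uv(1) by simp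
    then have S: "S = set u \<union> set v"
      using uv(2) disj(1) assms(2) by (simp add: insert_ident)
    then have "set u \<subseteq> S" "set v = S - set u"
      using disj(2) by auto
    then show ?case using w(3) uv
      by (simp add: split permutations_of_set_def)
  qed (simp add: split_beta)
  finally show ?thesis ..
qed

text \<open>Replaces permutations by words, from which letters can be removed without renumbering
  the rest.\<close>

lemma sum_permutes_eq_perm_sum:
  "(\<Sum>\<sigma> | \<sigma> permutes {1..n}. f (map \<sigma> [1..<n + 1])) = perm_sum f {1..n}"
proof -
  let ?h = "\<lambda>\<sigma>. map \<sigma> [1..<n + 1]"
  have inj: "inj_on ?h {\<sigma>. \<sigma> permutes {1..n}}"
  proof (rule inj_onI)
    fix \<sigma> \<tau> assume *: "\<sigma> \<in> {\<sigma>. \<sigma> permutes {1..n}}" "\<tau> \<in> {\<sigma>. \<sigma> permutes {1..n}}" "?h \<sigma> = ?h \<tau>"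
    have "\<sigma> i = \<tau> i" if "i \<in> {1..n}" for i
      using that * by (auto simp del: upt_Suc)
    then show "\<sigma> = \<tau>"
      using * by (metis ext mem_Collect_eq permutes_not_in)
  qed
  have "?h ` {\<sigma>. \<sigma> permutes {1..n}} \<subseteq> permutations_of_set {1..n}"
  proof clarify
    fix \<sigma> assume \<sigma>: "\<sigma> permutes {1..n}"
    have "set [1..<n + 1] = {1..n}" by auto
    then show "?h \<sigma> \<in> permutations_of_set {1..n}"
      using permutes_image [OF \<sigma>] permutes_inj_on [OF \<sigma>]
      by (simp add: permutations_of_set_def distinct_map del: upt_Suc)
  qed
  \<comment> \<open>Surjectivity comes from counting: both sets have \<open>fact n\<close>
    elements.\<close>
  moreover have "card (?h ` {\<sigma>. \<sigma> permutes {1..n}}) = card (permutations_of_set {1..n})"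
    by (subst card_image [OF inj]) (simp add: card_permutations)
  ultimately have "?h ` {\<sigma>. \<sigma> permutes {1..n}} = permutations_of_set {1..n}"
    by (intro card_subset_eq) auto
  then show ?thesis
    using sum.reindex [OF inj, of f] by (simp only: perm_sum_def o_def)
qed

section \<open>Bracketed products and reindexing of sums over subsets\<close>

lemma left_product_snoc:
  "left_product f (bs @ [b]) = (if bs = [] then b else f (left_product f bs) b)"
  by (cases bs) (auto simp: left_product_def)

lemma right_product_Cons:
  "right_product f (b # bs) = (if bs = [] then b else f b (right_product f bs))"
  by (simp add: right_product_def)

text \<open>Serves to carry the first identity, read in the opposite algebra, over to
  right-bracketed products.\<close>

lemma left_product_rev:
  "bs \<noteq> [] \<Longrightarrow> left_product f (rev bs) = right_product (\<lambda>x y. f y x) bs"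
  by (induction bs rule: list_nonempty_induct)
     (auto simp: left_product_snoc right_product_Cons left_product_def right_product_def)

text \<open>Associativity allows the first factor to be split off although the bracketing is to the
  left. \<open>U_term\<close> is unfolded this way, from its first block.\<close>

lemma left_product_assoc_Cons:
  assumes "\<And>x y z. f (f x y) z = f x (f y z)"
  shows "left_product f (b # bs) = (if bs = [] then b else f b (left_product f bs))"
proof (induction bs rule: rev_induct)
  case (snoc x xs)
  have "left_product f ((b # xs) @ [x]) = f (left_product f (b # xs)) x"
    by (subst left_product_snoc) simp
  then show ?case using snoc by (auto simp: left_product_snoc assms)
qed (simp add: left_product_def)

text \<open>Both sides run over the pairs of a subset \<open>U\<close> and an element
  \<open>s\<close> of \<open>S\<close> outside it.\<close>

lemma sum_Pow_diff_swap:
  assumes "finite S"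
  shows "(\<Sum>U\<in>Pow S. \<Sum>s\<in>S - U. g U s) = (\<Sum>s\<in>S. \<Sum>U\<in>Pow (S - {s}). g U s)"
  using assms
  by (subst (1 2) sum.Sigma)
     (auto simp: finite_subset
       intro!: sum.reindex_bij_witness [of _ "\<lambda>(s, U). (U, s)" "\<lambda>(U, s). (s, U)"])

text \<open>A pair \<open>(U, s)\<close> with \<open>s\<close> outside \<open>U\<close> corresponds
  to \<open>(insert s U, s)\<close>.\<close>

lemma sum_Pow_diff_shift:
  assumes "finite S"
  shows "(\<Sum>U\<in>Pow S. \<Sum>s\<in>S - U. g U s) = (\<Sum>U\<in>Pow S. \<Sum>s\<in>U. g (U - {s}) s)"
  using assms
  by (subst (1 2) sum.Sigma)
     (auto simp: finite_subset insert_absorb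
       intro!: sum.reindex_bij_witness [of _ "\<lambda>(U, s). (U - {s}, s)" "\<lambda>(U, s). (insert s U, s)"]
       dest: finite_subset)

section \<open>Expansion of the sum of left-bracketed \<open>\<succ>\<close>-products around a
  letter\<close>

context dendriform_algebra
begin

lemma succ_add_right: "x \<succ> (y + z) = x \<succ> y + x \<succ> z"
  by (rule module_hom.add [OF Vector_Spaces.linear.axioms(3) [OF linear_succ_right]])

lemma succ_diff_right: "x \<succ> (y - z) = x \<succ> y - x \<succ> z"
  by (rule module_hom.diff [OF Vector_Spaces.linear.axioms(3) [OF linear_succ_right]])

lemma prec_sum_left: "(\<Sum>i\<in>I. g i) \<prec> z = (\<Sum>i\<in>I. g i \<prec> z)"
  by (rule module_hom.sum [OF Vector_Spaces.linear.axioms(3) [OF linear_prec_left]])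

lemma prec_sum_right: "z \<prec> (\<Sum>i\<in>I. g i) = (\<Sum>i\<in>I. z \<prec> g i)"
  by (rule module_hom.sum [OF Vector_Spaces.linear.axioms(3) [OF linear_prec_right]])

lemma succ_sum_left: "(\<Sum>i\<in>I. g i) \<succ> z = (\<Sum>i\<in>I. g i \<succ> z)"
  by (rule module_hom.sum [OF Vector_Spaces.linear.axioms(3) [OF linear_succ_left]])

lemma succ_sum_right: "z \<succ> (\<Sum>i\<in>I. g i) = (\<Sum>i\<in>I. z \<succ> g i)"
  by (rule module_hom.sum [OF Vector_Spaces.linear.axioms(3) [OF linear_succ_right]])

text \<open>The passage to the opposite exchanges \<open>prec_prec\<close> with
  \<open>succ_succ\<close> and maps \<open>succ_prec\<close> to itself.\<close>

lemma opposite: "dendriform_algebra scale (\<lambda>x y. y \<succ> x) (\<lambda>x y. y \<prec> x)"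
  by (intro dendriform_algebra.intro dendriform_algebra_axioms.intro vector_space_axioms
        linear_prec_left linear_prec_right linear_succ_left linear_succ_right)
     (simp_all add: prec_prec succ_prec succ_succ add.commute)

text \<open>This is L(S). Its value at the empty set is unspecified, as that of
  \<open>left_product\<close> at \<open>[]\<close> is; hence the separate treatment of
  \<open>{}\<close> in \<open>act_succ\<close> and \<open>act_prec\<close>.\<close>

definition succ_sum :: "('i \<Rightarrow> 'a) \<Rightarrow> 'i set \<Rightarrow> 'a" where
  "succ_sum a = perm_sum (\<lambda>w. left_product (\<succ>) (map a w))"

text \<open>This is M(x, V). The word always contains \<open>x\<close>, so the case of empty
  \<open>V\<close> is meaningful and gives \<open>a x\<close>.\<close>

definition rhd_sum :: "('i \<Rightarrow> 'a) \<Rightarrow> 'i \<Rightarrow> 'i set \<Rightarrow> 'a" where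
  "rhd_sum a x = perm_sum (\<lambda>w. left_product (dend_rhd (\<prec>) (\<succ>)) (map a (x # w)))"

text \<open>
  Left multiplication by \<open>succ_sum a U\<close>, where the empty set acts as an adjoined unit
  with \<open>1 \<succ> y = y\<close> and \<open>1 \<prec> y = 0\<close>.
\<close>

definition act_succ :: "('i \<Rightarrow> 'a) \<Rightarrow> 'i set \<Rightarrow> 'a \<Rightarrow> 'a" where
  "act_succ a U y = (if U = {} then y else succ_sum a U \<succ> y)"

definition act_prec :: "('i \<Rightarrow> 'a) \<Rightarrow> 'i set \<Rightarrow> 'a \<Rightarrow> 'a" where
  "act_prec a U y = (if U = {} then 0 else succ_sum a U \<prec> y)"

lemma act_succ_add: "act_succ a U (y + z) = act_succ a U y + act_succ a U z"
  by (simp add: act_succ_def succ_add_right)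

lemma act_succ_diff: "act_succ a U (y - z) = act_succ a U y - act_succ a U z"
  by (simp add: act_succ_def succ_diff_right)

lemma act_succ_sum: "act_succ a U (\<Sum>i\<in>I. g i) = (\<Sum>i\<in>I. act_succ a U (g i))"
  by (simp add: act_succ_def succ_sum_right)

text \<open>Axiom \<open>succ_succ\<close> for nonempty \<open>U\<close>; for \<open>U = {}\<close>
  the unit convention makes both sides \<open>y \<succ> z\<close>.\<close>

lemma act_succ_succ: "(act_prec a U y + act_succ a U y) \<succ> z = act_succ a U (y \<succ> z)"
  by (simp add: act_prec_def act_succ_def succ_succ)

text \<open>Sort the words by their last letter \<open>s\<close>. The adjoined unit covers the
  one-letter words, where nothing precedes \<open>s\<close>.\<close>

lemma succ_sum_rec:
  assumes "finite U" "U \<noteq> {}"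
  shows "succ_sum a U = (\<Sum>s\<in>U. act_succ a (U - {s}) (a s))"
proof -
  have "succ_sum a U =
      (\<Sum>s\<in>U. perm_sum (\<lambda>w. left_product (\<succ>) (map a (w @ [s]))) (U - {s}))"
    unfolding succ_sum_def by (rule perm_sum_snoc [OF assms])
  also have "\<dots> = (\<Sum>s\<in>U. act_succ a (U - {s}) (a s))"
  proof (rule sum.cong [OF refl])
    fix s assume "s \<in> U"
    show "perm_sum (\<lambda>w. left_product (\<succ>) (map a (w @ [s]))) (U - {s}) = act_succ a (U - {s}) (a s)"
    proof (cases "U - {s} = {}")
      case True
      show ?thesis
        unfolding True by (simp add: act_succ_def left_product_def)
    next
      case False
      have "perm_sum (\<lambda>w. left_product (\<succ>) (map a (w @ [s]))) (U - {s}) =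
            perm_sum (\<lambda>w. left_product (\<succ>) (map a w) \<succ> a s) (U - {s})"
      proof (rule perm_sum_cong)
        fix w assume "set w = U - {s}"
        then have "w \<noteq> []" using False by (metis list.set(1))
        then show "left_product (\<succ>) (map a (w @ [s])) = left_product (\<succ>) (map a w) \<succ> a s"
          by (simp add: left_product_snoc)
      qed
      then show ?thesis
        using False by (simp add: act_succ_def succ_sum_def perm_sum_def succ_sum_left)
    qed
  qed
  finally show ?thesis .
qed

text \<open>Unfold L(U) at its last letter and move the bracket with
  \<open>succ_prec\<close>.\<close>

lemma act_prec_rec:
  assumes "finite U"
  shows "act_prec a U y = (\<Sum>s\<in>U. act_succ a (U - {s}) (a s \<prec> y))"
proof (cases "U = {}")
  case False
  have "act_prec a U y = (\<Sum>s\<in>U. act_succ a (U - {s}) (a s) \<prec> y)"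
    using False by (simp add: act_prec_def succ_sum_rec [OF assms False] prec_sum_left)
  also have "\<dots> = (\<Sum>s\<in>U. act_succ a (U - {s}) (a s \<prec> y))"
    by (intro sum.cong) (auto simp: act_succ_def succ_prec)
  finally show ?thesis .
qed (simp add: act_prec_def)

text \<open>Split off the last letter \<open>s\<close> and expand the outermost
  \<open>\<rhd>\<close> into its two terms; \<open>x\<close> stays in front.\<close>

lemma rhd_sum_rec:
  assumes "finite V"
  shows "rhd_sum a x V = (if V = {} then a x else 0) +
    (\<Sum>s\<in>V. rhd_sum a x (V - {s}) \<succ> a s - a s \<prec> rhd_sum a x (V - {s}))"
proof (cases "V = {}")
  case True
  then show ?thesis by (simp add: rhd_sum_def left_product_def)
next
  case False
  have step: "left_product (dend_rhd (\<prec>) (\<succ>)) (map a (x # w @ [s])) =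
      left_product (dend_rhd (\<prec>) (\<succ>)) (map a (x # w)) \<succ> a s
      - a s \<prec> left_product (dend_rhd (\<prec>) (\<succ>)) (map a (x # w))" for w s
    using left_product_snoc [of "dend_rhd (\<prec>) (\<succ>)" "map a (x # w)" "a s"]
    by (simp add: dend_rhd_def)
  show ?thesis
    unfolding rhd_sum_def perm_sum_snoc [OF assms False]
    using False by (simp add: step perm_sum_def sum_subtractf prec_sum_right succ_sum_left
        del: list.map)
qed

text \<open>Expand M at its last letter in the \<open>act_succ\<close> half only. The positive terms
  reassemble to L(S \<union> {x}), sorted by last letter, and the negative terms cancel the
  \<open>act_prec\<close> half.\<close>

lemma succ_sum_insert:
  assumes "finite S" "x \<notin> S"
  shows "succ_sum a (insert x S) =
    (\<Sum>U\<in>Pow S. act_prec a U (rhd_sum a x (S - U)) + act_succ a U (rhd_sum a x (S - U)))"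
  using assms
proof (induction S rule: measure_induct_rule [of card])
  case (less S)
  let ?M = "rhd_sum a x"
  have fin: "finite U" if "U \<subseteq> S" for U using that less.prems(1) by (rule finite_subset)
  have IH: "succ_sum a (insert x (S - {s})) =
      (\<Sum>U\<in>Pow (S - {s}). act_prec a U (?M (S - {s} - U)) + act_succ a U (?M (S - {s} - U)))"
    if "s \<in> S" for s
    using that less.prems
    by (intro less.IH) (auto intro!: card_Diff1_less simp del: card_Diff_insert card_Diff_singleton)
  have "(\<Sum>U\<in>Pow S. act_succ a U (?M (S - U))) =
      (\<Sum>U\<in>Pow S. act_succ a U (if S - U = {} then a x else 0)) +
      (\<Sum>U\<in>Pow S. \<Sum>s\<in>S - U. act_succ a U (?M (S - U - {s}) \<succ> a s)) -
      (\<Sum>U\<in>Pow S. \<Sum>s\<in>S - U. act_succ a U (a s \<prec> ?M (S - U - {s})))"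
    using less.prems(1)
    by (simp only: rhd_sum_rec [of "S - U" for U] finite_Diff act_succ_add act_succ_sum act_succ_diff
        sum.distrib sum_subtractf add_diff_eq)
  \<comment> \<open>Only \<open>U = S\<close> survives; it contributes the words that end in
    \<open>x\<close>.\<close>
  also have "(\<Sum>U\<in>Pow S. act_succ a U (if S - U = {} then a x else 0)) = act_succ a S (a x)"
  proof -
    have "act_succ a U 0 = 0" for U
      using act_succ_diff [of a U 0 0] by simp
    then have "(\<Sum>U\<in>Pow S. act_succ a U (if S - U = {} then a x else 0)) =
        (\<Sum>U\<in>{S}. act_succ a U (a x))"
      using less.prems(1) by (intro sum.mono_neutral_cong_right) auto
    then show ?thesis by simp
  qed
  \<comment> \<open>With \<open>s\<close> fixed first, \<open>U\<close> runs over the subsets of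
    \<open>S - {s}\<close>; \<open>act_succ_succ\<close> pulls out the factor \<open>a s\<close> and
    leaves the right-hand side of \<open>IH\<close>.\<close>
  also have "(\<Sum>U\<in>Pow S. \<Sum>s\<in>S - U. act_succ a U (?M (S - U - {s}) \<succ> a s)) =
      (\<Sum>s\<in>S. succ_sum a (insert x (S - {s})) \<succ> a s)"
  proof -
    have "S - U - {s} = S - {s} - U" for U s by auto
    then show ?thesis
      unfolding sum_Pow_diff_swap [OF less.prems(1)]
      by (intro sum.cong refl) (simp only: IH succ_sum_left act_succ_succ)
  qed
  \<comment> \<open>Moving \<open>s\<close> into \<open>U\<close> makes it the last letter of the
    front part, the shape that \<open>act_prec_rec\<close> sums up.\<close>
  also have "(\<Sum>U\<in>Pow S. \<Sum>s\<in>S - U. act_succ a U (a s \<prec> ?M (S - U - {s}))) =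
      (\<Sum>U\<in>Pow S. \<Sum>s\<in>U. act_succ a (U - {s}) (a s \<prec> ?M (S - (U - {s}) - {s})))"
    by (rule sum_Pow_diff_shift [OF less.prems(1)])
  also have "\<dots> = (\<Sum>U\<in>Pow S. act_prec a U (?M (S - U)))"
  proof (rule sum.cong [OF refl])
    fix U assume "U \<in> Pow S"
    moreover have "S - (U - {s}) - {s} = S - U" if "s \<in> U" for s using that by auto
    ultimately show "(\<Sum>s\<in>U. act_succ a (U - {s}) (a s \<prec> ?M (S - (U - {s}) - {s}))) =
        act_prec a U (?M (S - U))"
      by (simp add: act_prec_rec fin)
  qed
  \<comment> \<open>The last letter of a word on \<open>insert x S\<close> is either
    \<open>x\<close> or some \<open>s\<close> in \<open>S\<close>.\<close>
  also have "act_succ a S (a x) + (\<Sum>s\<in>S. succ_sum a (insert x (S - {s})) \<succ> a s) =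
      succ_sum a (insert x S)"
  proof -
    have "succ_sum a (insert x S) =
        act_succ a (insert x S - {x}) (a x) + (\<Sum>s\<in>S. act_succ a (insert x S - {s}) (a s))"
      using less.prems by (subst succ_sum_rec) auto
    moreover have "insert x S - {x} = S" using less.prems by auto
    moreover have "act_succ a (insert x S - {s}) (a s) = succ_sum a (insert x (S - {s})) \<succ> a s"
      if "s \<in> S" for s
    proof -
      have "insert x S - {s} = insert x (S - {s})" using that less.prems by auto
      then show ?thesis by (simp add: act_succ_def)
    qed
    ultimately show ?thesis by simp
  qed
  finally show ?case
    by (simp add: sum.distrib algebra_simps)
qed

text \<open>Both sums obey the same recursion over the letters in front of \<open>x\<close>. What
  matters is that \<open>x\<close> depends on \<open>S\<close> alone and not on the word.
  \<open>T\<close> and the choice of \<open>x\<close> stay abstract to allow the maximum here and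
  the minimum in the opposite algebra.\<close>

lemma succ_sum_eq_perm_sum:
  assumes T: "\<And>S. finite S \<Longrightarrow> S \<noteq> {} \<Longrightarrow>
      \<exists>x\<in>S. \<forall>u v. set (u @ x # v) = S \<longrightarrow> distinct (u @ x # v) \<longrightarrow>
        T (u @ x # v) = (let y = left_product (dend_rhd (\<prec>) (\<succ>)) (map a (x # v))
          in if u = [] then y else dend_mult (\<prec>) (\<succ>) (T u) y)"
    and "finite S" "S \<noteq> {}"
  shows "perm_sum (\<lambda>w. left_product (\<succ>) (map a w)) S = perm_sum T S"
  using assms(2,3) unfolding succ_sum_def [symmetric]
proof (induction S rule: measure_induct_rule [of card])
  case (less S)
  obtain x where x: "x \<in> S" and T': "\<And>u v. set (u @ x # v) = S \<Longrightarrow> distinct (u @ x # v) \<Longrightarrow>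
        T (u @ x # v) = (let y = left_product (dend_rhd (\<prec>) (\<succ>)) (map a (x # v))
          in if u = [] then y else dend_mult (\<prec>) (\<succ>) (T u) y)"
    using T [OF less.prems] by blast
  define S' where "S' = S - {x}"
  have S: "S = insert x S'" "x \<notin> S'" "finite S'"
    using x less.prems by (auto simp: S'_def)
  have "perm_sum (\<lambda>u. perm_sum (\<lambda>v. T (u @ x # v)) (S' - U)) U =
        act_prec a U (rhd_sum a x (S' - U)) + act_succ a U (rhd_sum a x (S' - U))"
    if U: "U \<in> Pow S'" for U
  proof -
    have eq: "perm_sum (\<lambda>u. perm_sum (\<lambda>v. T (u @ x # v)) (S' - U)) U =
      perm_sum (\<lambda>u. perm_sum (\<lambda>v. let y = left_product (dend_rhd (\<prec>) (\<succ>)) (map a (x # v))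
          in if u = [] then y else dend_mult (\<prec>) (\<succ>) (T u) y) (S' - U)) U"
      using U S(2) by (intro perm_sum_cong T') (auto simp: S(1))
    show ?thesis
    \<comment> \<open>If \<open>x\<close> comes first there is a single block, matching the unit
      convention. Otherwise bilinearity factors the double sum into L(U) * M(x, S' - U).\<close>
    proof (cases "U = {}")
      case True
      then show ?thesis
        unfolding eq by (simp add: act_prec_def act_succ_def rhd_sum_def)
    next
      case False
      have "card U < card S"
        using U S less.prems by (intro psubset_card_mono) auto
      then have "succ_sum a U = perm_sum T U"
        using False U S by (intro less.IH) (auto intro: finite_subset)
      moreover have "perm_sum (\<lambda>u. perm_sum (\<lambda>v. T (u @ x # v)) (S' - U)) U =
          perm_sum (\<lambda>u. perm_sum (\<lambda>v. dend_mult (\<prec>) (\<succ>) (T u)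
            (left_product (dend_rhd (\<prec>) (\<succ>)) (map a (x # v)))) (S' - U)) U"
        unfolding eq using False by (intro perm_sum_cong)
          (simp only: Let_def set_empty split: if_split, blast)
      ultimately show ?thesis
        using False
        by (simp add: act_prec_def act_succ_def rhd_sum_def perm_sum_def dend_mult_def
            prec_sum_left succ_sum_left sum.distrib)
           (simp add: prec_sum_right succ_sum_right sum.distrib)
    qed
  qed
  then show ?case
    unfolding S(1) succ_sum_insert [OF S(3,2)] perm_sum_insert [OF S(3,2)] by simp
qed

end


section \<open>Blocks after adding a largest or a smallest cut\<close>

lemma blocks_empty: "blocks n {} b = [map b [1..<n + 1]]"
  by (simp add: blocks_def cuts_def)

lemma blocks_not_Nil: "blocks n K b \<noteq> []"
  by (simp add: blocks_def)

lemma length_cuts: "finite K \<Longrightarrow> length (cuts n K) = card K + 2"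
  by (simp add: cuts_def)

text \<open>The endpoint \<open>l\<close> of the shorter cut list turns into an interior
  cut.\<close>

lemma cuts_insert_max:
  assumes "K \<subseteq> {1..<l}"
  shows "cuts n (insert l K) = cuts l K @ [n]"
proof -
  have fin: "finite K" using assms by (rule finite_subset) simp
  let ?xs = "sorted_list_of_set K @ [l]"
  have "sorted ?xs" "distinct ?xs" "set ?xs = insert l K"
    using assms fin by (auto simp: sorted_append)
  then have "sorted_list_of_set (insert l K) = ?xs"
    by (metis sorted_list_of_set.idem_if_sorted_distinct)
  then show ?thesis by (simp add: cuts_def)
qed

lemma blocks_insert_max:
  assumes "K \<subseteq> {1..<l}"
  shows "blocks n (insert l K) b = blocks l K b @ [map b [l + 1..<n + 1]]"
proof -
  have fin: "finite K" using assms by (rule finite_subset) simp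
  have card: "card (insert l K) = card K + 1"
    using fin assms by (subst card_insert_disjoint) auto
  have "cuts l K ! (card K + 1) = l"
    using fin by (simp add: cuts_def nth_append)
  then show ?thesis
    unfolding blocks_def cuts_insert_max [OF assms] card
    using length_cuts [OF fin, of l] by (simp add: nth_append del: upt_Suc add: upt_Suc_append)
qed

text \<open>Shifting by \<open>l\<close> sends the initial 0 of the shorter list to the cut
  \<open>l\<close> and its endpoint \<open>n - l\<close> to \<open>n\<close>.\<close>

lemma cuts_insert_min:
  assumes "K \<subseteq> {1..<n - l}" "l \<le> n"
  shows "cuts n (insert l ((+) l ` K)) = 0 # map ((+) l) (cuts (n - l) K)"
proof -
  have fin: "finite K" using assms(1) by (rule finite_subset) simp
  let ?xs = "l # map ((+) l) (sorted_list_of_set K)"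
  have "sorted ?xs" "distinct ?xs" "set ?xs = insert l ((+) l ` K)"
    using assms fin by (auto simp: distinct_map sorted_map)
  then have "sorted_list_of_set (insert l ((+) l ` K)) = ?xs"
    by (metis sorted_list_of_set.idem_if_sorted_distinct)
  then show ?thesis using assms(2) by (simp add: cuts_def)
qed

lemma blocks_insert_min:
  assumes "K \<subseteq> {1..<n - l}" "l \<le> n"
  shows "blocks n (insert l ((+) l ` K)) b = map b [1..<l + 1] # blocks (n - l) K (\<lambda>i. b (l + i))"
proof -
  have fin: "finite K" using assms(1) by (rule finite_subset) simp
  have card: "card (insert l ((+) l ` K)) = card K + 1"
    using fin assms by (subst card_insert_disjoint) (auto simp: card_image)
  have shift: "map b [l + c + 1..<l + d + 1] = map (\<lambda>i. b (l + i)) [c + 1..<d + 1]" for c d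
    by (rule nth_equalityI) (auto simp del: upt_Suc simp: add.assoc)
  let ?c = "cuts (n - l) K"
  have nth: "(0 # map ((+) l) ?c) ! (i + 1) = l + ?c ! i" if "i < card K + 2" for i
    using that length_cuts [OF fin, of "n - l"] by simp
  \<comment> \<open>Index 0 is the new first block; index \<open>i + 1\<close> is block
    \<open>i\<close> of the remaining word.\<close>
  have "[0..<card K + 1 + 1] = 0 # map (\<lambda>i. i + 1) [0..<card K + 1]"
    using map_Suc_upt [of 0 "card K + 1"] by (simp add: upt_conv_Cons del: upt_Suc)
  then have "blocks n (insert l ((+) l ` K)) b = map b [1..<l + ?c ! 0 + 1] #
      map (\<lambda>i. map b [l + ?c ! i + 1..<l + ?c ! (i + 1) + 1]) [0..<card K + 1]"
    unfolding blocks_def cuts_insert_min [OF assms] card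
    using nth [of 0] by (auto simp: nth [simplified] simp del: upt_Suc)
  moreover have "?c ! 0 = 0" by (simp add: cuts_def)
  ultimately show ?thesis
    unfolding blocks_def by (simp only: shift add_0_right)
qed

text \<open>Induction on the largest cut, which reduces the claim to the shorter word in front of
  it.\<close>

lemma blocks_cong:
  assumes "K \<subseteq> {1..<n}" "\<And>i. i \<in> {1..n} \<Longrightarrow> b i = c i"
  shows "blocks n K b = blocks n K c"
proof -
  have "finite K" using assms(1) by (rule finite_subset) simp
  then show ?thesis using assms
  proof (induction K arbitrary: n rule: finite_linorder_max_induct)
    case empty
    then show ?case by (simp add: blocks_empty del: upt_Suc)
  next
    case (insert l K)
    then have K: "K \<subseteq> {1..<l}" by auto
    have "blocks l K b = blocks l K c"
      using insert.prems K by (intro insert.IH) auto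
    then show ?case
      unfolding blocks_insert_max [OF K] using insert.prems(2) by auto
  qed
qed

section \<open>Cut sets and block products at the extremal letter\<close>

lemma E_set_subset: "E_set n \<sigma> \<subseteq> {1..<n}"
  by (auto simp: E_set_def)

lemma F_set_subset: "F_set n \<sigma> \<subseteq> {1..<n}"
  by (auto simp: F_set_def)

lemma T_term_cong:
  assumes "\<And>i. i \<in> {1..n} \<Longrightarrow> \<sigma> i = \<tau> i"
  shows "T_term prec succ n \<sigma> a = T_term prec succ n \<tau> a"
proof -
  have "E_set n \<sigma> = E_set n \<tau>"
    unfolding E_set_def using assms
    by (intro Collect_cong conj_cong ball_cong refl) auto
  moreover have "blocks n (E_set n \<tau>) (\<lambda>i. a (\<sigma> i)) = blocks n (E_set n \<tau>) (\<lambda>i. a (\<tau> i))"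
    by (rule blocks_cong [OF E_set_subset]) (simp add: assms)
  ultimately show ?thesis by (simp add: T_term_def)
qed

lemma U_term_cong:
  assumes "\<And>i. i \<in> {1..n} \<Longrightarrow> \<sigma> i = \<tau> i"
  shows "U_term prec succ n \<sigma> a = U_term prec succ n \<tau> a"
proof -
  have "F_set n \<sigma> = F_set n \<tau>"
    using assms by (auto simp: F_set_def)
  moreover have "blocks n (F_set n \<tau>) (\<lambda>i. a (\<sigma> i)) = blocks n (F_set n \<tau>) (\<lambda>i. a (\<tau> i))"
    by (rule blocks_cong [OF F_set_subset]) (simp add: assms)
  ultimately show ?thesis by (simp add: U_term_def)
qed

text \<open>A cut \<open>k\<close> marks a left-to-right maximum at position \<open>k + 1\<close>.
  None comes after the overall maximum at \<open>m + 1\<close>, and those before it depend on the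
  first \<open>m\<close> letters only. For \<open>m = 0\<close> there is no cut, since cuts start at
  1.\<close>

lemma E_set_max:
  assumes "m < n" "\<And>j. j \<in> {1..n} \<Longrightarrow> j \<noteq> m + 1 \<Longrightarrow> \<sigma> j < \<sigma> (m + 1)"
  shows "E_set n \<sigma> = (if m = 0 then {} else insert m (E_set m \<sigma>))"
proof -
  have "k \<le> m" if "k \<in> E_set n \<sigma>" for k
  proof (rule ccontr)
    assume "\<not> k \<le> m"
    then have "\<sigma> (m + 1) < \<sigma> (k + 1)"
      using that by (auto simp: E_set_def)
    moreover have "\<sigma> (k + 1) < \<sigma> (m + 1)"
      using that \<open>\<not> k \<le> m\<close> by (intro assms(2)) (auto simp: E_set_def)
    ultimately show False by simp
  qed
  moreover have "m \<in> E_set n \<sigma>" if "m \<noteq> 0"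
    using that assms by (auto simp: E_set_def)
  moreover have "k \<in> E_set n \<sigma> \<longleftrightarrow> k \<in> E_set m \<sigma>" if "k < m" for k
    using that assms(1) by (auto simp: E_set_def)
  moreover have "0 \<notin> E_set n \<sigma>" by (simp add: E_set_def)
  ultimately show ?thesis
    using E_set_subset [of m \<sigma>] by (auto simp: le_less)
qed

text \<open>Cuts are the positions \<open>l < n\<close> of right-to-left minima. None precedes the
  overall minimum, and those after it see only the letters that follow.\<close>

lemma F_set_min:
  assumes "l \<in> {1..n}" "\<And>j. j \<in> {1..n} \<Longrightarrow> j \<noteq> l \<Longrightarrow> \<sigma> l < \<sigma> j"
  shows "F_set n \<sigma> = (if l = n then {} else insert l ((+) l ` F_set (n - l) (\<lambda>i. \<sigma> (l + i))))"
proof -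
  have ge: "l \<le> k" if "k \<in> F_set n \<sigma>" for k
  proof (rule ccontr)
    assume "\<not> l \<le> k"
    then have "\<sigma> k < \<sigma> l" "\<sigma> l < \<sigma> k"
      using that assms(1) by (auto simp: F_set_def intro!: assms(2))
    then show False by simp
  qed
  have l: "l \<in> F_set n \<sigma>" if "l \<noteq> n"
    using that assms by (auto simp: F_set_def)
  \<comment> \<open>The index 0 must be excluded: \<open>l\<close> itself may be a cut, while 0
    never is.\<close>
  have shift: "l + k \<in> F_set n \<sigma> \<longleftrightarrow> k \<in> F_set (n - l) (\<lambda>i. \<sigma> (l + i))" if "k \<noteq> 0" for k
  proof -
    have "{l + k + 1..n} = (+) l ` {k + 1..n - l}"
      using assms(1) by (simp add: image_add_atLeastAtMost)
    then show ?thesis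
      using that assms(1) by (auto simp: F_set_def simp del: image_add_atLeastAtMost)
  qed
  show ?thesis
  proof (cases "l = n")
    case True
    then show ?thesis using ge F_set_subset [of n \<sigma>] by fastforce
  next
    case False
    have "k \<in> (+) l ` F_set (n - l) (\<lambda>i. \<sigma> (l + i))" if "k \<in> F_set n \<sigma>" "k \<noteq> l" for k
      using that ge [OF that(1)] shift [of "k - l"] by (auto intro!: image_eqI [of _ _ "k - l"])
    moreover have "l + k \<in> F_set n \<sigma>" if "k \<in> F_set (n - l) (\<lambda>i. \<sigma> (l + i))" for k
      using that shift [of k] by (auto simp: F_set_def)
    ultimately show ?thesis using False l by auto
  qed
qed

text \<open>The largest cut is \<open>m\<close>, so the last block starts at the maximal letter, as
  \<open>succ_sum_eq_perm_sum\<close> requires.\<close>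

lemma T_term_max:
  assumes "m < n" "\<And>j. j \<in> {1..n} \<Longrightarrow> j \<noteq> m + 1 \<Longrightarrow> \<sigma> j < \<sigma> (m + 1)"
  shows "T_term prec succ n \<sigma> a =
    (let y = left_product (dend_rhd prec succ) (map (\<lambda>i. a (\<sigma> i)) [m + 1..<n + 1])
     in if m = 0 then y else dend_mult prec succ (T_term prec succ m \<sigma> a) y)"
proof -
  have E: "E_set n \<sigma> = (if m = 0 then {} else insert m (E_set m \<sigma>))"
    by (rule E_set_max) (use assms in auto)
  show ?thesis
  proof (cases "m = 0")
    case True
    then show ?thesis
      using E by (simp add: T_term_def blocks_empty left_product_def del: upt_Suc)
  next
    case False
    then show ?thesis
      using E
      by (simp add: T_term_def blocks_insert_max [OF E_set_subset] left_product_snoc blocks_not_Nil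
          del: upt_Suc)
  qed
qed

text \<open>The smallest cut is \<open>l\<close>, so the first block ends at the minimal letter;
  \<open>assoc\<close> brings that block to the front of the product.\<close>

lemma U_term_min:
  assumes "l \<in> {1..n}" "\<And>j. j \<in> {1..n} \<Longrightarrow> j \<noteq> l \<Longrightarrow> \<sigma> l < \<sigma> j"
    and assoc: "\<And>x y z. dend_mult prec succ (dend_mult prec succ x y) z =
      dend_mult prec succ x (dend_mult prec succ y z)"
  shows "U_term prec succ n \<sigma> a =
    (let y = right_product (dend_lhd prec succ) (map (\<lambda>i. a (\<sigma> i)) [1..<l + 1])
     in if l = n then y
        else dend_mult prec succ y (U_term prec succ (n - l) (\<lambda>i. \<sigma> (l + i)) a))"
proof -
  have F: "F_set n \<sigma> = (if l = n then {} else insert l ((+) l ` F_set (n - l) (\<lambda>i. \<sigma> (l + i))))"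
    by (rule F_set_min) (use assms in auto)
  show ?thesis
  proof (cases "l = n")
    case True
    then show ?thesis
      using F by (simp add: U_term_def blocks_empty left_product_def del: upt_Suc)
  next
    case False
    then show ?thesis
      using F assms(1)
      by (simp add: U_term_def blocks_insert_min [OF F_set_subset]
          left_product_assoc_Cons [OF assoc] blocks_not_Nil del: upt_Suc)
  qed
qed

text \<open>A word is read as a function on positions counted from 1, while \<open>!\<close> counts
  from 0; hence the \<open>i - 1\<close> here and below.\<close>

lemma map_nth_shift: "map (\<lambda>i. f ((u @ v) ! (i - 1))) [length u + 1..<length (u @ v) + 1] = map f v"
  by (rule nth_equalityI) (auto simp: nth_append simp del: upt_Suc)

lemma map_nth_prefix: "map (\<lambda>i. f ((u @ v) ! (i - 1))) [1..<length u + 1] = map f u"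
  by (rule nth_equalityI) (auto simp: nth_append simp del: upt_Suc)

lemma nth_distinct_middle:
  assumes "distinct (u @ x # v)" "j < length (u @ x # v)" "j \<noteq> length u"
  shows "(u @ x # v) ! j \<in> set (u @ x # v) - {x}"
  using assms nth_eq_iff_index_eq [of "u @ x # v" j "length u"] nth_mem [of j "u @ x # v"] by simp

text \<open>\<open>T_term\<close> reads a permutation only on \<open>{1..n}\<close>, where it agrees
  with its word.\<close>

lemma sum_T_term_eq_perm_sum:
  "(\<Sum>\<sigma> | \<sigma> permutes {1..n}. T_term prec succ n \<sigma> a) =
   perm_sum (\<lambda>w. T_term prec succ (length w) (\<lambda>i. w ! (i - 1)) a) {1..n}"
  unfolding sum_permutes_eq_perm_sum [symmetric]
  by (intro sum.cong refl) (auto intro!: T_term_cong simp del: upt_Suc)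

lemma sum_U_term_eq_perm_sum:
  "(\<Sum>\<sigma> | \<sigma> permutes {1..n}. U_term prec succ n \<sigma> a) =
   perm_sum (\<lambda>w. U_term prec succ (length w) (\<lambda>i. w ! (i - 1)) a) {1..n}"
  unfolding sum_permutes_eq_perm_sum [symmetric]
  by (intro sum.cong refl) (auto intro!: U_term_cong simp del: upt_Suc)

section \<open>Both identities for words over a finite set of indices\<close>

context dendriform_algebra
begin

text \<open>The abstract recursion applies with \<open>x = Max S\<close>; \<open>T_term_max\<close>
  supplies it at \<open>m = length u\<close>.\<close>

lemma perm_sum_left_product_succ:
  fixes S :: "nat set"
  assumes "finite S" "S \<noteq> {}"
  shows "perm_sum (\<lambda>w. left_product (\<succ>) (map a w)) S =
    perm_sum (\<lambda>w. T_term (\<prec>) (\<succ>) (length w) (\<lambda>i. w ! (i - 1)) a) S"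
proof (rule succ_sum_eq_perm_sum [OF _ assms])
  fix S :: "nat set" assume S: "finite S" "S \<noteq> {}"
  let ?T = "\<lambda>w. T_term (\<prec>) (\<succ>) (length w) (\<lambda>i. w ! (i - 1)) a"
  have "?T (u @ x # v) = (let y = left_product (dend_rhd (\<prec>) (\<succ>)) (map a (x # v))
          in if u = [] then y else dend_mult (\<prec>) (\<succ>) (?T u) y)"
    if w: "set (u @ x # v) = S" "distinct (u @ x # v)" and x: "x = Max S" for u x v
  proof -
    let ?w = "u @ x # v"
    have "?w ! (j - 1) < ?w ! (length u + 1 - 1)"
      if "j \<in> {1..length ?w}" "j \<noteq> length u + 1" for j
    proof -
      have "j - 1 < length ?w" "j - 1 \<noteq> length u"
        using that by (cases j; simp)+
      then have "?w ! (j - 1) \<in> S - {x}"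
        using nth_distinct_middle [OF w(2)] unfolding w(1) by blast
      then show ?thesis using S(1) x by (auto simp: le_less dest: Max_ge [of S])
    qed
    then have "?T ?w = (let y = left_product (dend_rhd (\<prec>) (\<succ>))
          (map (\<lambda>i. a (?w ! (i - 1))) [length u + 1..<length ?w + 1])
        in if length u = 0 then y
           else dend_mult (\<prec>) (\<succ>) (T_term (\<prec>) (\<succ>) (length u) (\<lambda>i. ?w ! (i - 1)) a) y)"
      by (intro T_term_max) simp_all
    moreover have "T_term (\<prec>) (\<succ>) (length u) (\<lambda>i. ?w ! (i - 1)) a = ?T u"
      by (rule T_term_cong) (auto simp: nth_append)
    ultimately show ?thesis
      by (simp only: map_nth_shift length_0_conv)
  qed
  then show "\<exists>x\<in>S. \<forall>u v. set (u @ x # v) = S \<longrightarrow> distinct (u @ x # v) \<longrightarrow>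
      ?T (u @ x # v) = (let y = left_product (dend_rhd (\<prec>) (\<succ>)) (map a (x # v))
        in if u = [] then y else dend_mult (\<prec>) (\<succ>) (?T u) y)"
    using Max_in [OF S] by blast
qed

text \<open>The abstract recursion is used in the opposite algebra with \<open>x = Min S\<close> and
  the terms \<open>?U (rev w)\<close>. Reversal turns the first block, ending at the minimum, into a
  last block that starts there.\<close>

lemma perm_sum_right_product_prec:
  fixes S :: "nat set"
  assumes "finite S" "S \<noteq> {}"
  shows "perm_sum (\<lambda>w. right_product (\<prec>) (map a w)) S =
    perm_sum (\<lambda>w. U_term (\<prec>) (\<succ>) (length w) (\<lambda>i. w ! (i - 1)) a) S"
proof -
  let ?U = "\<lambda>w. U_term (\<prec>) (\<succ>) (length w) (\<lambda>i. w ! (i - 1)) a"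
  have rhd: "dend_rhd (\<lambda>x y. y \<succ> x) (\<lambda>x y. y \<prec> x) = (\<lambda>x y. dend_lhd (\<prec>) (\<succ>) y x)"
    by (simp add: dend_rhd_def dend_lhd_def fun_eq_iff)
  have mult: "dend_mult (\<lambda>x y. y \<succ> x) (\<lambda>x y. y \<prec> x) = (\<lambda>x y. dend_mult (\<prec>) (\<succ>) y x)"
    by (simp add: dend_mult_def fun_eq_iff add.commute)
  have "perm_sum (\<lambda>w. left_product (\<lambda>x y. y \<prec> x) (map a w)) S = perm_sum (\<lambda>w. ?U (rev w)) S"
  proof (rule dendriform_algebra.succ_sum_eq_perm_sum [OF opposite _ assms], unfold rhd mult)
    fix S :: "nat set" assume S: "finite S" "S \<noteq> {}"
    have "?U (rev (u @ x # v)) =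
        (let y = left_product (\<lambda>x y. dend_lhd (\<prec>) (\<succ>) y x) (map a (x # v))
          in if u = [] then y else dend_mult (\<prec>) (\<succ>) y (?U (rev u)))"
      if w: "set (u @ x # v) = S" "distinct (u @ x # v)" and x: "x = Min S" for u x v
    proof -
      \<comment> \<open>\<open>?w\<close> is the reversed word and \<open>?l\<close> the position of
        \<open>x\<close> in it, counted from 1.\<close>
      let ?w = "rev v @ x # rev u" and ?l = "length v + 1"
      have "?w ! (?l - 1) < ?w ! (j - 1)"
        if "j \<in> {1..length ?w}" "j \<noteq> ?l" for j
      proof -
        have "distinct ?w" "set ?w = S" using w by auto
        moreover have "j - 1 < length ?w" "j - 1 \<noteq> length (rev v)"
          using that by (cases j; simp)+
        ultimately have "?w ! (j - 1) \<in> S - {x}"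
          using nth_distinct_middle [of "rev v" x "rev u" "j - 1"] by simp
        then have "x < ?w ! (j - 1)" using S(1) x by (auto simp: le_less dest: Min_le [of S])
        then show ?thesis by (simp add: nth_append)
      qed
      then have U: "?U ?w = (let y = right_product (dend_lhd (\<prec>) (\<succ>))
            (map (\<lambda>i. a (?w ! (i - 1))) [1..<?l + 1])
          in if ?l = length ?w then y
             else dend_mult (\<prec>) (\<succ>) y
               (U_term (\<prec>) (\<succ>) (length ?w - ?l) (\<lambda>i. ?w ! (?l + i - 1)) a))"
        by (intro U_term_min dend_mult_assoc) simp_all
      have "length ?w - ?l = length (rev u)" by simp
      moreover have "U_term (\<prec>) (\<succ>) (length (rev u)) (\<lambda>i. ?w ! (?l + i - 1)) a = ?U (rev u)"
        by (rule U_term_cong) (auto simp: nth_append nth_Cons')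
      moreover have "map (\<lambda>i. a (?w ! (i - 1))) [1..<?l + 1] = rev (map a (x # v))"
        using map_nth_prefix [of a "rev v @ [x]" "rev u"] by (simp add: rev_map del: upt_Suc)
      moreover have "right_product (dend_lhd (\<prec>) (\<succ>)) (rev (map a (x # v))) =
          left_product (\<lambda>x y. dend_lhd (\<prec>) (\<succ>) y x) (map a (x # v))"
        using left_product_rev [of "rev (map a (x # v))" "\<lambda>x y. dend_lhd (\<prec>) (\<succ>) y x"] by simp
      moreover have "?l = length ?w \<longleftrightarrow> u = []" "rev (u @ x # v) = ?w" by simp_all
      ultimately show ?thesis
        using U by (simp only:)
    qed
    then show "\<exists>x\<in>S. \<forall>u v. set (u @ x # v) = S \<longrightarrow> distinct (u @ x # v) \<longrightarrow>
        ?U (rev (u @ x # v)) =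
          (let y = left_product (\<lambda>x y. dend_lhd (\<prec>) (\<succ>) y x) (map a (x # v))
          in if u = [] then y else dend_mult (\<prec>) (\<succ>) y (?U (rev u)))"
      using Min_in [OF S] by blast
  qed
  \<comment> \<open>Reindexing by \<open>rev\<close> removes the reversal on this side. The same
    reindexing on the other side introduces one, so that \<open>left_product_rev\<close> yields
    right-bracketed products.\<close>
  also have "\<dots> = perm_sum ?U S" by (rule perm_sum_rev)
  also have "perm_sum (\<lambda>w. left_product (\<lambda>x y. y \<prec> x) (map a w)) S =
      perm_sum (\<lambda>w. left_product (\<lambda>x y. y \<prec> x) (map a (rev w))) S"
    by (rule perm_sum_rev [symmetric])
  also have "\<dots> = perm_sum (\<lambda>w. right_product (\<prec>) (map a w)) S"
  proof (rule perm_sum_cong)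
    fix w assume "set w = S"
    then have "map a w \<noteq> []" using assms(2) by auto
    then show "left_product (\<lambda>x y. y \<prec> x) (map a (rev w)) = right_product (\<prec>) (map a w)"
      using left_product_rev [of "map a w" "\<lambda>x y. y \<prec> x"] by (simp add: rev_map)
  qed
  finally show ?thesis .
qed

end

section \<open>Return from words to permutations\<close>

theorem theorem5p1:
  fixes scale :: "'k::field \<Rightarrow> 'a::ab_group_add \<Rightarrow> 'a"
    and prec succ :: "'a \<Rightarrow> 'a \<Rightarrow> 'a"
    and n :: nat and a :: "nat \<Rightarrow> 'a"
  assumes "dendriform_algebra scale prec succ" and "n \<ge> 1"
  shows "(\<Sum>\<sigma> | \<sigma> permutes {1..n}. left_product succ (map (\<lambda>i. a (\<sigma> i)) [1 ..< n + 1]))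
           = (\<Sum>\<sigma> | \<sigma> permutes {1..n}. T_term prec succ n \<sigma> a)
       \<and> (\<Sum>\<sigma> | \<sigma> permutes {1..n}. right_product prec (map (\<lambda>i. a (\<sigma> i)) [1 ..< n + 1]))
           = (\<Sum>\<sigma> | \<sigma> permutes {1..n}. U_term prec succ n \<sigma> a)"
proof -
  interpret dendriform_algebra scale prec succ by (rule assms(1))
  \<comment> \<open>Exhibits each summand as a function of the word of \<sigma>, the form
    \<open>sum_permutes_eq_perm_sum\<close> expects.\<close>
  have word: "map (\<lambda>i. a (\<sigma> i)) [1..<n + 1] = map a (map \<sigma> [1..<n + 1])" for \<sigma>
    by (simp only: map_map o_def)
  have S: "finite {1..n}" "{1..n} \<noteq> {}" using assms(2) by auto
  show ?thesis
    unfolding word sum_T_term_eq_perm_sum sum_U_term_eq_perm_sum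
      perm_sum_left_product_succ [OF S, symmetric] perm_sum_right_product_prec [OF S, symmetric]
    using sum_permutes_eq_perm_sum [of "\<lambda>w. left_product succ (map a w)" n]
      sum_permutes_eq_perm_sum [of "\<lambda>w. right_product prec (map a w)" n]
    by (simp only:)
qed

end
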